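(* Let $X$ be an $n$-dimensional complex Banach space with an absolute norm and let $k\ge2$ be an integer. Then $n^{(k)}(X)=1$ if and only if $X$ is isometric to $\ell_\infty^n$.
   Context: A norm on $\mathbb{C}^n$ is absolute if $\|(a_1,\dots,a_n)\|=\|(|a_1|,\dots,|a_n|)\|$ for all scalars and $\|e_j\|=1$ for the canonical basis vectors. For $f:B_X\to X$ bounded, the numerical radius is $v(f)=\sup\{|x^*(f(x))|:x\in S_X,\ x^*\in S_{X^*},\ x^*(x)=1\}$. The $k$-polynomial numerical index is $n^{(k)}(X)=\inf\{v(P):P\in\mathcal{P}({}^kX:X),\ \|P\|=1\}$, where $\mathcal{P}({}^kX:X)$ is the space of $k$-homogeneous polynomials $X\to X$ with norm $\|P\|=\sup_{x\in B_X}\|P(x)\|$. *)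

theory Defs
  imports "HOL-Analysis.Analysis"
begin

text \<open>The space X is C^n (index type 'n) equipped with a norm N.\<close>

definition is_norm_fn :: "(complex ^ 'n \<Rightarrow> real) \<Rightarrow> bool" where
  "is_norm_fn N \<longleftrightarrow>
     (\<forall>x. N x = 0 \<longleftrightarrow> x = 0) \<and>
     (\<forall>a x. N (a *s x) = cmod a * N x) \<and>
     (\<forall>x y. N (x + y) \<le> N x + N y)"

definition abs_vec :: "complex ^ 'n \<Rightarrow> complex ^ 'n" where
  "abs_vec x = (\<chi> j. complex_of_real (cmod (x $ j)))"

definition absolute_norm :: "(complex ^ 'n::finite \<Rightarrow> real) \<Rightarrow> bool" where
  "absolute_norm N \<longleftrightarrow> is_norm_fn N \<and>
     (\<forall>x. N x = N (abs_vec x)) \<and> (\<forall>j. N (axis j 1) = 1)"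

definition clin_functional :: "(complex ^ 'n \<Rightarrow> complex) \<Rightarrow> bool" where
  "clin_functional f \<longleftrightarrow> (\<forall>a x y. f (a *s x + y) = a * f x + f y)"

definition clin_op :: "(complex ^ 'n \<Rightarrow> complex ^ 'm) \<Rightarrow> bool" where
  "clin_op T \<longleftrightarrow> (\<forall>a x y. T (a *s x + y) = a *s T x + T y)"

definition dual_norm :: "(complex ^ 'n \<Rightarrow> real) \<Rightarrow> (complex ^ 'n \<Rightarrow> complex) \<Rightarrow> real" where
  "dual_norm N f = Sup {cmod (f y) | y. N y \<le> 1}"

definition multilinear_map :: "nat \<Rightarrow> ((nat \<Rightarrow> complex ^ 'n) \<Rightarrow> complex ^ 'm) \<Rightarrow> bool" where
  "multilinear_map k A \<longleftrightarrow>
     (\<forall>xs ys. (\<forall>i<k. xs i = ys i) \<longrightarrow> A xs = A ys) \<and>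
     (\<forall>i<k. \<forall>xs a u v. A (xs(i := a *s u + v)) = a *s A (xs(i := u)) + A (xs(i := v)))"

definition homog_poly :: "nat \<Rightarrow> (complex ^ 'n \<Rightarrow> complex ^ 'n) \<Rightarrow> bool" where
  "homog_poly k P \<longleftrightarrow> (\<exists>A. multilinear_map k A \<and> (\<forall>x. P x = A (\<lambda>_. x)))"

definition poly_norm :: "(complex ^ 'n \<Rightarrow> real) \<Rightarrow> (complex ^ 'n \<Rightarrow> complex ^ 'n) \<Rightarrow> real" where
  "poly_norm N P = Sup {N (P x) | x. N x \<le> 1}"

definition num_radius :: "(complex ^ 'n \<Rightarrow> real) \<Rightarrow> (complex ^ 'n \<Rightarrow> complex ^ 'n) \<Rightarrow> real" where
  "num_radius N P = Sup {cmod (f (P x)) | x f. N x = 1 \<and> clin_functional f \<and>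
                                               dual_norm N f = 1 \<and> f x = 1}"

definition poly_num_index :: "(complex ^ 'n \<Rightarrow> real) \<Rightarrow> nat \<Rightarrow> real" where
  "poly_num_index N k = Inf {num_radius N P | P. homog_poly k P \<and> poly_norm N P = 1}"

definition sup_norm :: "complex ^ 'n::finite \<Rightarrow> real" where
  "sup_norm x = Max (range (\<lambda>j. cmod (x $ j)))"

end

theory Submission
  imports Defs "HOL-Complex_Analysis.Conformal_Mappings"
begin

text \<open>
  If \<open>N\<close> is isometric to the supremum norm, the maximum principle, applied in one coordinate of
  the polydisc after the other, moves the point where a coordinate of \<open>P\<close> is large to the torus,
  where every normalised coordinate functional is a support functional; so the numerical radius
  equals the norm.

  Conversely, let \<open>S\<close> be a minimal set of coordinates with \<open>N (1\<^sub>S) > 1\<close>. Consider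
  \<open>P = q u\<close>, where \<open>q\<close> is a scalar polynomial in the coordinates from \<open>S\<close> all of whose maximisers
  on the unit ball have nonzero coordinates of equal phase on \<open>S\<close>, and \<open>u\<close> is the unit vector
  proportional to \<open>\<Sum>\<^sub>j w\<^sub>j e\<^sub>j\<close> (\<open>j \<in> S\<close>) with pairwise distinct unimodular \<open>w\<^sub>j\<close>. If the numerical
  radius of \<open>P\<close> equals its norm, it is attained at a maximiser \<open>x\<close> of \<open>q\<close> and a support functional
  \<open>a\<close> at \<open>x\<close> with \<open>\<bar>a(u)\<bar> = 1\<close>. As the norm is absolute, the coefficients of \<open>a\<close> on \<open>S\<close> have equal
  phases, so \<open>\<bar>a(u)\<bar> = 1\<close> leaves only one of them nonzero, and then \<open>\<bar>a(u)\<bar> \<le> 1 / N (1\<^sub>S) < 1\<close>.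
  Hence \<open>N (1, \<dots>, 1) \<le> 1\<close>, i.e. \<open>N\<close> is the supremum norm.
\<close>

section \<open>Linear functionals and operators in coordinates\<close>

lemma clin_functional_expansion:
  assumes "clin_functional f"
  shows "f x = (\<Sum>j\<in>UNIV. x $ j * f (axis j 1))"
proof -
  have f: "f (a *s x + y) = a * f x + f y" for a x y
    using assms by (simp add: clin_functional_def)
  have f0: "f 0 = 0"
    using f[of 1 0 0] by simp
  have "f (\<Sum>j\<in>F. x $ j *s axis j 1) = (\<Sum>j\<in>F. x $ j * f (axis j 1))" if "finite F" for F
    using that by induction (simp_all add: f f0)
  from this[of UNIV] show ?thesis
    by (simp add: basis_expansion)
qed

lemma clin_functional_scale:
  assumes "clin_functional f"
  shows "f (a *s x) = a * f x"
proof -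
  have f: "f (a *s x + y) = a * f x + f y" for a x y
    using assms by (simp add: clin_functional_def)
  from f[of 1 0 0] f[of a x 0] show ?thesis by simp
qed

lemma clin_functional_component:
  assumes "clin_op T"
  shows "clin_functional (\<lambda>x. T x $ j)"
  using assms by (simp add: clin_op_def clin_functional_def)

lemma clin_op_inv:
  assumes "clin_op T" "bij T"
  shows "clin_op (inv T)"
  unfolding clin_op_def
proof (intro allI)
  fix a x y
  have "T (a *s inv T x + inv T y) = a *s x + y"
    using assms by (simp add: clin_op_def bij_is_surj surj_f_inv_f)
  then show "inv T (a *s x + y) = a *s inv T x + inv T y"
    by (metis assms(2) bij_inv_eq_iff)
qed

section \<open>Multilinear maps and homogeneous polynomials\<close>

lemma multilinear_map_cong:
  assumes "multilinear_map k A" "\<And>i. i < k \<Longrightarrow> xs i = ys i"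
  shows "A xs = A ys"
  using assms(1)[unfolded multilinear_map_def, THEN conjunct1, rule_format, of xs ys] assms(2)
  by simp

lemma multilinear_map_linear:
  assumes "multilinear_map k A" "i < k"
  shows "A (xs(i := a *s u + v)) = a *s A (xs(i := u)) + A (xs(i := v))"
  using assms(1)[unfolded multilinear_map_def, THEN conjunct2, rule_format] assms(2)
  by simp

text \<open>Expanding the multilinear form slot by slot in the canonical basis writes each
  coordinate of \<open>P\<close> with sums and products of coordinates of the argument. The property
  \<open>Q\<close> stands for continuity and, later, for holomorphy along a curve
  \<open>\<phi>\<close>.\<close>

lemma homog_poly_closure:
  fixes P :: "complex ^ 'n::finite \<Rightarrow> complex ^ 'n" and \<phi> :: "'a \<Rightarrow> complex ^ 'n"
  assumes P: "homog_poly k P"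
    and const: "\<And>c. Q (\<lambda>_. c)"
    and add: "\<And>f g. Q f \<Longrightarrow> Q g \<Longrightarrow> Q (\<lambda>z. f z + g z)"
    and mult: "\<And>f g. Q f \<Longrightarrow> Q g \<Longrightarrow> Q (\<lambda>z. f z * g z)"
    and \<phi>: "\<And>j. Q (\<lambda>z. \<phi> z $ j)"
  shows "Q (\<lambda>z. P (\<phi> z) $ i)"
proof -
  obtain A where A: "multilinear_map k A" and PA: "\<And>x. P x = A (\<lambda>_. x)"
    using P by (auto simp: homog_poly_def)
  have lin: "clin_functional (\<lambda>x. A (v(m := x)) $ i)" if "m < k" for v m
    by (simp add: clin_functional_def multilinear_map_linear[OF A that])
  have sum: "Q (\<lambda>z. \<Sum>j\<in>F. f j z)" if "finite F" "\<And>j. Q (f j)" for F :: "'n set" and f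
    using that(1) by induction (auto intro: const add that(2))
  \<comment> \<open>The first \<open>m\<close> slots hold the varying vector, the others fixed ones.
    \<open>v\<close> must be arbitrary, since the induction step puts basis vectors into slot
    \<open>m\<close>.\<close>
  have "Q (\<lambda>z. A (\<lambda>i. if i < m then \<phi> z else v i) $ i)" if "m \<le> k" for m v
    using that
  proof (induction m arbitrary: v)
    case 0
    then show ?case by (simp add: const)
  next
    case (Suc m)
    have "A (\<lambda>i. if i < Suc m then \<phi> z else v i) $ i
        = (\<Sum>j\<in>UNIV. \<phi> z $ j * A (\<lambda>i. if i < m then \<phi> z else (v(m := axis j 1)) i) $ i)" for z
    proof -
      have "A (\<lambda>i. if i < Suc m then \<phi> z else v i) $ i
          = A ((\<lambda>i. if i < m then \<phi> z else v i)(m := \<phi> z)) $ i"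
        by (rule arg_cong[where f = "\<lambda>v. A v $ i"]) (auto simp: fun_eq_iff)
      also have "\<dots> = (\<Sum>j\<in>UNIV. \<phi> z $ j * A ((\<lambda>i. if i < m then \<phi> z else v i)(m := axis j 1)) $ i)"
        using Suc.prems by (intro clin_functional_expansion[OF lin]) simp
      also have "\<dots> = (\<Sum>j\<in>UNIV. \<phi> z $ j * A (\<lambda>i. if i < m then \<phi> z else (v(m := axis j 1)) i) $ i)"
        by (intro sum.cong refl arg_cong2[where f = "(*)"] arg_cong[where f = "\<lambda>v. A v $ i"])
          (auto simp: fun_eq_iff)
      finally show ?thesis .
    qed
    then show ?case
      using Suc by (simp add: sum mult \<phi>)
  qed
  from this[of k "\<lambda>_. 0"] have "Q (\<lambda>z. A (\<lambda>i. if i < k then \<phi> z else 0) $ i)" by simp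
  moreover have "A (\<lambda>i. if i < k then \<phi> z else 0) = P (\<phi> z)" for z
    unfolding PA by (rule multilinear_map_cong[OF A]) simp
  ultimately show ?thesis by simp
qed

lemma homog_poly_continuous:
  fixes P :: "complex ^ 'n::finite \<Rightarrow> complex ^ 'n"
  assumes "homog_poly k P"
  shows "continuous_on A P"
proof -
  have "continuous_on A (\<lambda>x. P x $ i)" for i
    by (rule homog_poly_closure[OF assms, where Q = "continuous_on A" and \<phi> = "\<lambda>x. x"])
      (auto intro!: continuous_intros)
  then have "continuous_on A (\<lambda>x. \<chi> i. P x $ i)"
    by (rule continuous_on_vec_lambda)
  then show ?thesis by simp
qed

text \<open>A separate form in each slot makes mixed products such as
  \<open>s ^ l * (x $ j)\<^sup>2\<close> available.\<close>

lemma homog_poly_prod: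
  assumes "\<And>i. i < k \<Longrightarrow> clin_functional (L i)"
  shows "homog_poly k (\<lambda>x. (\<Prod>i<k. L i x) *s u)"
  unfolding homog_poly_def
proof (intro exI[of _ "\<lambda>xs. (\<Prod>i<k. L i (xs i)) *s u"] conjI allI refl)
  show "multilinear_map k (\<lambda>xs. (\<Prod>i<k. L i (xs i)) *s u)"
    unfolding multilinear_map_def
  proof (intro conjI allI impI)
    fix xs ys :: "nat \<Rightarrow> complex ^ 'a"
    assume "\<forall>i<k. xs i = ys i"
    then show "(\<Prod>i<k. L i (xs i)) *s u = (\<Prod>i<k. L i (ys i)) *s u" by simp
  next
    fix i xs a v w
    assume i: "i < k"
    have *: "(\<Prod>j<k. L j ((xs(i := y)) j)) = L i y * (\<Prod>j\<in>{..<k}-{i}. L j (xs j))" for y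
      using i by (subst prod.remove[of _ i]) auto
    show "(\<Prod>j<k. L j ((xs(i := a *s v + w)) j)) *s u
        = a *s ((\<Prod>j<k. L j ((xs(i := v)) j)) *s u) + (\<Prod>j<k. L j ((xs(i := w)) j)) *s u"
      unfolding * using assms[OF i]
      by (simp add: clin_functional_def vec_eq_iff algebra_simps)
  qed
qed

lemma homog_poly_add:
  assumes "homog_poly k P" "homog_poly k R"
  shows "homog_poly k (\<lambda>x. P x + R x)"
proof -
  obtain A B where A: "multilinear_map k A" "\<And>x. P x = A (\<lambda>_. x)"
    and B: "multilinear_map k B" "\<And>x. R x = B (\<lambda>_. x)"
    using assms by (auto simp: homog_poly_def)
  have "multilinear_map k (\<lambda>xs. A xs + B xs)"
    unfolding multilinear_map_def
  proof (intro conjI allI impI)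
    fix xs ys :: "nat \<Rightarrow> complex ^ 'a"
    assume "\<forall>i<k. xs i = ys i"
    then show "A xs + B xs = A ys + B ys"
      by (simp add: multilinear_map_cong[OF A(1), of xs ys] multilinear_map_cong[OF B(1), of xs ys])
  next
    fix i xs a u v
    assume i: "i < k"
    show "A (xs(i := a *s u + v)) + B (xs(i := a *s u + v))
        = a *s (A (xs(i := u)) + B (xs(i := u))) + (A (xs(i := v)) + B (xs(i := v)))"
      unfolding multilinear_map_linear[OF A(1) i] multilinear_map_linear[OF B(1) i]
      by (simp add: vec_eq_iff algebra_simps)
  qed
  then show ?thesis
    unfolding homog_poly_def using A(2) B(2) by (intro exI[of _ "\<lambda>xs. A xs + B xs"]) simp
qed

lemma homog_poly_sum:
  assumes "finite F" "F \<noteq> {}" "\<And>j. j \<in> F \<Longrightarrow> homog_poly k (P j)"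
  shows "homog_poly k (\<lambda>x. \<Sum>j\<in>F. P j x)"
  using assms by (induction rule: finite_ne_induct) (auto intro: homog_poly_add)

section \<open>Phases of complex numbers\<close>

text \<open>After rotating the sum onto the nonnegative real axis, equality in the triangle
  inequality forces each real part to equal the modulus of its term. If the sum is 0, all terms
  vanish and the convention \<open>sgn 0 = 0\<close> does no harm.\<close>

lemma cmod_sum_eq_sum_cmod:
  fixes z :: "'a \<Rightarrow> complex"
  assumes "finite S" "(\<Sum>j\<in>S. cmod (z j)) \<le> cmod (\<Sum>j\<in>S. z j)" "j \<in> S"
  shows "z j = cmod (z j) * sgn (\<Sum>j\<in>S. z j)"
proof (cases "(\<Sum>j\<in>S. z j) = 0")
  case True
  then have "(\<Sum>j\<in>S. cmod (z j)) = 0"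
    using assms(2) by (simp add: order_antisym sum_nonneg)
  then show ?thesis
    using assms by (simp add: sum_nonneg_eq_0_iff)
next
  case False
  define \<theta> where "\<theta> = sgn (\<Sum>j\<in>S. z j)"
  have \<theta>: "cmod \<theta> = 1" "\<theta> * cnj \<theta> = 1"
    using False by (auto simp: \<theta>_def norm_sgn complex_norm_square[symmetric])
  have "(\<Sum>j\<in>S. z j) = cmod (\<Sum>j\<in>S. z j) * \<theta>"
    using False by (simp add: \<theta>_def sgn_eq)
  then have "cnj \<theta> * (\<Sum>j\<in>S. z j) = cmod (\<Sum>j\<in>S. z j) * (\<theta> * cnj \<theta>)"
    by (metis mult.assoc mult.commute)
  then have "(\<Sum>j\<in>S. cnj \<theta> * z j) = cmod (\<Sum>j\<in>S. z j)"
    unfolding \<theta> by (simp add: sum_distrib_left)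
  then have *: "(\<Sum>j\<in>S. Re (cnj \<theta> * z j)) = cmod (\<Sum>j\<in>S. z j)"
    by (metis Re_complex_of_real Re_sum)
  have le: "Re (cnj \<theta> * z j) \<le> cmod (z j)" for j
    using complex_Re_le_cmod[of "cnj \<theta> * z j"] \<theta> by (simp add: norm_mult)
  have "(\<Sum>j\<in>S. cmod (z j) - Re (cnj \<theta> * z j)) = 0"
    using assms(2) le * by (intro antisym sum_nonneg) (auto simp: sum_subtractf)
  then have "Re (cnj \<theta> * z j) = cmod (cnj \<theta> * z j)"
    using assms(1,3) le \<theta> by (simp add: sum_nonneg_eq_0_iff norm_mult)
  then have "cnj \<theta> * z j = cmod (z j)"
    using \<theta> cmod_power2[of "cnj \<theta> * z j"] by (simp add: complex_eq_iff norm_mult)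
  then have "(\<theta> * cnj \<theta>) * z j = cmod (z j) * \<theta>"
    by (metis mult.assoc mult.commute)
  then show ?thesis
    unfolding \<theta> by (simp add: \<theta>_def)
qed

text \<open>The angles \<open>1 / (1 + n)\<close> lie in the range of the principal argument, so
  \<open>Arg\<close> recovers them.\<close>

lemma ex_inj_unimodular: "\<exists>w :: 'n::finite \<Rightarrow> complex. inj w \<and> (\<forall>j. cmod (w j) = 1)"
proof -
  obtain g :: "'n \<Rightarrow> nat" where g: "inj g"
    using finite_imp_inj_to_nat_seg[of "UNIV :: 'n set"] by auto
  have "inj (\<lambda>j. cis (1 / (1 + real (g j))))"
  proof (rule injI)
    fix i j assume eq: "cis (1 / (1 + real (g i))) = cis (1 / (1 + real (g j)))"
    have "Arg (cis (1 / (1 + real (g l)))) = 1 / (1 + real (g l))" for l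
    proof (rule Arg_cis)
      have "1 / (1 + real (g l)) > 0" "1 / (1 + real (g l)) \<le> 1" by auto
      then show "1 / (1 + real (g l)) \<in> {-pi<..pi}"
        using pi_gt3 unfolding greaterThanAtMost_iff by linarith
    qed
    then have "1 / (1 + real (g i)) = 1 / (1 + real (g j))"
      using eq by metis
    then have "g i = g j" by simp
    then show "i = j" using g by (simp add: inj_eq)
  qed
  moreover have "\<forall>j. cmod (cis (1 / (1 + real (g j)))) = 1"
    by simp
  ultimately show ?thesis
    by blast
qed

section \<open>Absolute norms, dual norms and the numerical radius\<close>

locale absolute_normed =
  fixes N :: "complex ^ 'n::finite \<Rightarrow> real"
  assumes absolute_norm: "absolute_norm N"
begin

lemma N_eq_0: "N x = 0 \<longleftrightarrow> x = 0"
  and N_scale: "N (a *s x) = cmod a * N x"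
  and N_add: "N (x + y) \<le> N x + N y"
  and N_axis: "N (axis j 1) = 1"
  using absolute_norm unfolding absolute_norm_def is_norm_fn_def by blast+

lemma N_cong_cmod:
  assumes "\<And>j. cmod (x $ j) = cmod (y $ j)"
  shows "N x = N y"
proof -
  have "abs_vec x = abs_vec y"
    using assms by (simp add: abs_vec_def)
  moreover have "N z = N (abs_vec z)" for z
    using absolute_norm unfolding absolute_norm_def by blast
  ultimately show ?thesis by metis
qed

lemma N_abs_vec: "N (abs_vec x) = N x"
  by (rule N_cong_cmod) (simp add: abs_vec_def)

text \<open>Changing the sign of all coordinates but the \<open>j\<close>-th preserves
  \<open>N\<close>; adding the result to \<open>x\<close> leaves twice the \<open>j\<close>-th
  component.\<close>

lemma cmod_component_le: "cmod (x $ j) \<le> N x"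
proof -
  define y :: "complex ^ 'n" where "y = (\<chi> i. if i = j then x $ i else - (x $ i))"
  have "x + y = (2 * x $ j) *s axis j 1"
    by (simp add: y_def vec_eq_iff axis_def)
  then have "N (x + y) = 2 * cmod (x $ j)"
    by (simp add: N_scale N_axis norm_mult)
  moreover have "N y = N x"
    by (rule N_cong_cmod) (simp add: y_def)
  ultimately show ?thesis
    using N_add[of x y] by simp
qed

lemma N_nonneg: "0 \<le> N x"
  using order_trans[OF norm_ge_zero cmod_component_le] .

lemma N_sum:
  assumes "finite F"
  shows "N (\<Sum>j\<in>F. v j) \<le> (\<Sum>j\<in>F. N (v j))"
  using assms
proof induction
  case empty
  then show ?case using N_eq_0[of 0] by simp
next
  case (insert j F)
  then show ?case using N_add[of "v j" "\<Sum>j\<in>F. v j"] by simp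
qed

lemma N_le_sum_cmod: "N x \<le> (\<Sum>j\<in>UNIV. cmod (x $ j))"
  using N_sum[of UNIV "\<lambda>j. x $ j *s axis j 1"] by (simp add: basis_expansion N_scale N_axis)

text \<open>\<open>N\<close> is Lipschitz for the Euclidean distance, with the dimension as
  constant.\<close>

lemma continuous_on_N: "continuous_on A N"
proof (rule continuous_onI)
  fix x :: "complex ^ 'n" and e :: real
  assume e: "0 < e"
  have diff: "N u - N v \<le> CARD('n) * dist u v" for u v
  proof -
    have "N u - N v \<le> N (u - v)"
      using N_add[of "u - v" v] by simp
    also have "\<dots> \<le> (\<Sum>j\<in>UNIV. cmod ((u - v) $ j))"
      by (rule N_le_sum_cmod)
    also have "\<dots> \<le> (\<Sum>j\<in>(UNIV :: 'n set). dist u v)"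
      unfolding dist_norm by (intro sum_mono Finite_Cartesian_Product.norm_nth_le)
    finally show ?thesis by simp
  qed
  show "\<exists>d>0. \<forall>x'\<in>A. dist x' x < d \<longrightarrow> dist (N x') (N x) \<le> e"
  proof (intro exI[of _ "e / CARD('n)"] conjI ballI impI)
    fix x' assume "dist x' x < e / CARD('n)"
    then have "CARD('n) * dist x' x \<le> e"
      by (simp add: field_simps)
    then show "dist (N x') (N x) \<le> e"
      using diff[of x x'] diff[of x' x] by (simp add: dist_real_def dist_commute)
  qed (use e in simp)
qed

lemma compact_ball: "compact {x. N x \<le> 1}"
proof -
  have "norm x \<le> CARD('n)" if "N x \<le> 1" for x
  proof -
    have "norm x \<le> (\<Sum>j\<in>UNIV. cmod (x $ j))"
      unfolding norm_vec_def by (rule L2_set_le_sum) simp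
    also have "\<dots> \<le> (\<Sum>j\<in>(UNIV :: 'n set). 1)"
      using that cmod_component_le[of x] by (intro sum_mono) (meson order_trans)
    finally show ?thesis by simp
  qed
  then have "bounded {x. N x \<le> 1}"
    unfolding bounded_iff by blast
  moreover have "closed {x. N x \<le> 1}"
    by (intro closed_Collect_le continuous_on_N continuous_on_const)
  ultimately show ?thesis
    by (simp add: compact_eq_bounded_closed)
qed

text \<open>\<open>dual_norm\<close> is a real supremum, so the values on the unit ball must first
  be shown bounded; scaling \<open>y\<close> to norm 1 then gives the estimate.\<close>

lemma cmod_le_dual_norm:
  assumes f: "clin_functional f" and d: "dual_norm N f = 1"
  shows "cmod (f y) \<le> N y"
proof (cases "y = 0")
  case True
  then show ?thesis
    using clin_functional_expansion[OF f, of 0] N_nonneg[of 0] by simp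
next
  case False
  have bdd: "bdd_above {cmod (f y) | y. N y \<le> 1}"
  proof (rule bdd_aboveI, safe)
    fix y assume y: "N y \<le> 1"
    have "cmod (f y) \<le> (\<Sum>j\<in>UNIV. cmod (y $ j * f (axis j 1)))"
      by (subst clin_functional_expansion[OF f]) (rule norm_sum)
    also have "\<dots> \<le> (\<Sum>j\<in>UNIV. 1 * cmod (f (axis j 1)))"
      unfolding norm_mult using y cmod_component_le[of y]
      by (intro sum_mono mult_right_mono) (auto intro: order_trans)
    finally show "cmod (f y) \<le> (\<Sum>j\<in>UNIV. 1 * cmod (f (axis j 1)))" .
  qed
  have pos: "N y > 0"
    using False N_nonneg[of y] N_eq_0[of y] by linarith
  let ?z = "complex_of_real (1 / N y) *s y"
  have "N ?z = 1"
    using pos by (simp add: N_scale norm_divide)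
  then have "cmod (f ?z) \<le> dual_norm N f"
    unfolding dual_norm_def by (intro cSup_upper[OF _ bdd]) auto
  moreover have "f ?z = complex_of_real (1 / N y) * f y"
    by (rule clin_functional_scale[OF f])
  ultimately have "1 / N y * cmod (f y) \<le> 1"
    using pos d by (metis N_nonneg norm_mult norm_of_real abs_of_nonneg zero_le_divide_1_iff)
  then show ?thesis
    using pos by (simp add: field_simps)
qed

lemma dual_norm_eq_1I:
  assumes "\<And>y. cmod (f y) \<le> N y" and "N x = 1" and "f x = 1"
  shows "dual_norm N f = 1"
  unfolding dual_norm_def
proof (rule cSup_eq_maximum)
  show "1 \<in> {cmod (f y) | y. N y \<le> 1}"
    using assms(2,3) by (auto intro!: exI[of _ x])
  show "z \<le> 1" if "z \<in> {cmod (f y) | y. N y \<le> 1}" for z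
    using that assms(1) by (auto intro: order_trans)
qed

lemma bdd_above_poly_norm:
  assumes "continuous_on UNIV P"
  shows "bdd_above {N (P x) | x. N x \<le> 1}"
proof -
  have "continuous_on {x. N x \<le> 1} (N \<circ> P)"
    using assms by (intro continuous_on_compose continuous_on_N) (rule continuous_on_subset, auto)
  then have "compact ((N \<circ> P) ` {x. N x \<le> 1})"
    by (rule compact_continuous_image[OF _ compact_ball])
  then have "bdd_above ((N \<circ> P) ` {x. N x \<le> 1})"
    by (intro bounded_imp_bdd_above compact_imp_bounded)
  then show ?thesis
    by (simp add: image_Collect conj_commute)
qed

lemma cmod_functional_le_poly_norm:
  assumes "continuous_on UNIV P" "N x = 1" "clin_functional f" "dual_norm N f = 1"
  shows "cmod (f (P x)) \<le> poly_norm N P"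
proof -
  have "cmod (f (P x)) \<le> N (P x)"
    by (rule cmod_le_dual_norm[OF assms(3,4)])
  also have "\<dots> \<le> poly_norm N P"
    unfolding poly_norm_def using assms(2)
    by (intro cSup_upper bdd_above_poly_norm assms(1)) auto
  finally show ?thesis .
qed

lemma bdd_above_num_radius:
  assumes "continuous_on UNIV P"
  shows "bdd_above {cmod (f (P x)) | x f. N x = 1 \<and> clin_functional f \<and> dual_norm N f = 1 \<and> f x = 1}"
  using cmod_functional_le_poly_norm[OF assms] by (intro bdd_aboveI[of _ "poly_norm N P"]) auto

text \<open>A basis vector and its coordinate functional form an admissible pair, so the supremum in
  \<open>num_radius\<close> is meaningful.\<close>

lemma num_radius_set_nonempty:
  "{cmod (f (P x)) | x f. N x = 1 \<and> clin_functional f \<and> dual_norm N f = 1 \<and> f x = 1} \<noteq> {}"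
proof -
  obtain j :: 'n where True by simp
  have "dual_norm N (\<lambda>y. y $ j) = 1"
    by (rule dual_norm_eq_1I[of _ "axis j 1"]) (simp_all add: cmod_component_le N_axis)
  moreover have "clin_functional (\<lambda>y :: complex ^ 'n. y $ j)"
    by (simp add: clin_functional_def)
  ultimately show ?thesis
    using N_axis[of j] by (auto intro!: exI[of _ "axis j 1"] exI[of _ "\<lambda>y. y $ j"])
qed

lemma num_radius_le_poly_norm:
  assumes "continuous_on UNIV P"
  shows "num_radius N P \<le> poly_norm N P"
  unfolding num_radius_def
  using cmod_functional_le_poly_norm[OF assms]
  by (intro cSup_least num_radius_set_nonempty) auto

text \<open>Supplies the lower bound required by the infimum in
  \<open>poly_num_index\<close>.\<close>

lemma num_radius_nonneg:
  assumes "continuous_on UNIV P"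
  shows "0 \<le> num_radius N P"
proof -
  obtain r where r: "r \<in> {cmod (f (P x)) | x f. N x = 1 \<and> clin_functional f \<and> dual_norm N f = 1 \<and> f x = 1}"
    using num_radius_set_nonempty by blast
  then have "0 \<le> r" by auto
  also have "r \<le> num_radius N P"
    unfolding num_radius_def by (rule cSup_upper[OF r bdd_above_num_radius[OF assms]])
  finally show ?thesis .
qed

end

section \<open>The maximum principle on the polydisc\<close>

lemma max_modulus_circle:
  assumes "\<phi> holomorphic_on UNIV" "cmod z \<le> 1"
  shows "\<exists>z'. cmod z' = 1 \<and> cmod (\<phi> z) \<le> cmod (\<phi> z')"
proof -
  have cont: "continuous_on A \<phi>" for A
    using assms(1) holomorphic_on_imp_continuous_on holomorphic_on_subset by blast
  have "\<exists>z'\<in>sphere 0 1. \<forall>y\<in>sphere 0 1. cmod (\<phi> y) \<le> cmod (\<phi> z')"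
    by (intro continuous_attains_sup continuous_on_norm cont) auto
  then obtain z' where z': "cmod z' = 1" "\<And>y. cmod y = 1 \<Longrightarrow> cmod (\<phi> y) \<le> cmod (\<phi> z')"
    by auto
  have "cmod (\<phi> z) \<le> cmod (\<phi> z')"
  proof (rule maximum_modulus_frontier[of \<phi> "cball 0 1"])
    show "\<phi> holomorphic_on interior (cball 0 1)"
      using assms(1) by (rule holomorphic_on_subset) simp
  qed (use assms(2) cont z'(2) in auto)
  with z'(1) show ?thesis by blast
qed

lemma max_modulus_torus:
  fixes h :: "complex ^ 'n::finite \<Rightarrow> complex"
  assumes hol: "\<And>y i. (\<lambda>z. h (\<chi> l. if l = i then z else y $ l)) holomorphic_on UNIV"
    and y: "\<And>j. cmod (y $ j) \<le> 1"
  shows "\<exists>y'. (\<forall>j. cmod (y' $ j) = 1) \<and> cmod (h y) \<le> cmod (h y')"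
proof -
  \<comment> \<open>Coordinates in \<open>F\<close> are already on the circle; the others are kept
    in the disc so that the one-variable principle applies to them next.\<close>
  have "\<exists>y'. (\<forall>j\<in>F. cmod (y' $ j) = 1) \<and> (\<forall>j. cmod (y' $ j) \<le> 1) \<and> cmod (h y) \<le> cmod (h y')"
    if "finite F" for F
    using that
  proof induction
    case empty
    then show ?case using y by auto
  next
    case (insert i F)
    then obtain y' where y': "\<And>j. j \<in> F \<Longrightarrow> cmod (y' $ j) = 1" "\<And>j. cmod (y' $ j) \<le> 1"
      "cmod (h y) \<le> cmod (h y')"
      by auto
    obtain z where z: "cmod z = 1" "cmod (h (\<chi> l. if l = i then y' $ i else y' $ l))
        \<le> cmod (h (\<chi> l. if l = i then z else y' $ l))"
      using max_modulus_circle[OF hol[where y = y' and i = i] y'(2)[of i]] by blast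
    have "(\<chi> l. if l = i then y' $ i else y' $ l) = y'"
      by (simp add: vec_eq_iff)
    with z y' show ?case
      by (intro exI[of _ "\<chi> l. if l = i then z else y' $ l"]) auto
  qed
  from this[of UNIV] show ?thesis by auto
qed

section \<open>The supremum norm and spaces isometric to it\<close>

lemma cmod_le_sup_norm: "cmod (x $ j) \<le> sup_norm x"
  by (simp add: sup_norm_def)

lemma sup_norm_attained: "\<exists>j. cmod (x $ j) = sup_norm x"
proof -
  have "sup_norm x \<in> range (\<lambda>j. cmod (x $ j))"
    unfolding sup_norm_def by (rule Max_in) auto
  then show ?thesis by auto
qed

context absolute_normed
begin

lemma num_radius_eq_poly_norm:
  fixes T :: "complex ^ 'n \<Rightarrow> complex ^ 'n"
  assumes T: "clin_op T" "bij T" and NT: "\<And>x. sup_norm (T x) = N x"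
    and P: "homog_poly k P"
  shows "num_radius N P = poly_norm N P"
proof (rule antisym)
  note contP = homog_poly_continuous[OF P]
  show "num_radius N P \<le> poly_norm N P"
    by (rule num_radius_le_poly_norm[OF contP])
  have "N (P x) \<le> num_radius N P" if x: "N x \<le> 1" for x
  proof -
    obtain j where j: "cmod (T (P x) $ j) = N (P x)"
      using sup_norm_attained NT by metis
    \<comment> \<open>\<open>P\<close> is transported to the supremum norm, and \<open>j\<close> is
      a coordinate carrying the norm of \<open>P x\<close>.\<close>
    define h where "h = (\<lambda>y. T (P (inv T y)) $ j)"
    have component: "T v $ j = (\<Sum>l\<in>UNIV. v $ l * T (axis l 1) $ j)" for v
      by (rule clin_functional_expansion[OF clin_functional_component[OF T(1)]])
    have hol: "(\<lambda>z. h (\<chi> l. if l = i then z else y $ l)) holomorphic_on UNIV" for y i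
    proof -
      have "(\<lambda>z. inv T (\<chi> l. if l = i then z else y $ l) $ r) holomorphic_on UNIV" for r
      proof -
        have "(\<lambda>z. if l = i then z else y $ l) holomorphic_on UNIV" for l
          by (cases "l = i") auto
        then show ?thesis
          \<comment> \<open>The explicit instance confines the rewriting to vectors built with
            \<open>\<chi>\<close>; otherwise it would apply again to the basis vectors it
            produces.\<close>
          unfolding clin_functional_expansion[OF clin_functional_component[OF clin_op_inv[OF T]],
              of "\<chi> l. _ l"]
          by (auto intro!: holomorphic_intros)
      qed
      then have "(\<lambda>z. P (inv T (\<chi> l. if l = i then z else y $ l)) $ r) holomorphic_on UNIV" for r
        by (intro homog_poly_closure[OF P, where Q = "\<lambda>f. f holomorphic_on UNIV"])
          (auto intro!: holomorphic_intros)
      then show ?thesis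
        unfolding h_def by (subst component) (auto intro!: holomorphic_intros)
    qed
    have "cmod (T x $ l) \<le> 1" for l
      using cmod_le_sup_norm[of "T x" l] x NT[of x] by simp
    then obtain y where y: "\<And>l. cmod (y $ l) = 1" and hy: "cmod (h (T x)) \<le> cmod (h y)"
      using max_modulus_torus[OF hol, of "T x"] by blast
    define x' where "x' = inv T y"
    have Tx': "T x' = y"
      using T(2) by (simp add: x'_def bij_is_surj surj_f_inv_f)
    have x': "N x' = 1"
      using sup_norm_attained[of y] y NT[of x'] Tx' by auto
    \<comment> \<open>On the torus \<open>y $ j\<close> is unimodular, so this normalised coordinate
      supports the ball at \<open>x'\<close> and loses nothing of the modulus of
      \<open>h y\<close>.\<close>
    define f where "f = (\<lambda>v. T v $ j / y $ j)"
    have y0: "y $ j \<noteq> 0"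
      using y[of j] by auto
    have f: "clin_functional f" "f x' = 1"
      using clin_functional_component[OF T(1), of j] y0
      by (auto simp: f_def clin_functional_def Tx' add_divide_distrib)
    have "cmod (f v) \<le> N v" for v
      using cmod_le_sup_norm[of "T v" j] NT[of v] y[of j] by (simp add: f_def norm_divide)
    then have "dual_norm N f = 1"
      using x' f(2) by (rule dual_norm_eq_1I)
    then have "cmod (f (P x')) \<le> num_radius N P"
      unfolding num_radius_def using x' f by (intro cSup_upper bdd_above_num_radius contP) auto
    moreover have "N (P x) \<le> cmod (f (P x'))"
      using hy j y[of j] T(2) by (simp add: h_def f_def x'_def norm_divide bij_is_inj)
    ultimately show ?thesis by simp
  qed
  moreover have "{N (P x) | x. N x \<le> 1} \<noteq> {}"
    using eq_refl[OF N_axis] by blast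
  ultimately show "poly_norm N P \<le> num_radius N P"
    unfolding poly_norm_def by (intro cSup_least) auto
qed

lemma poly_num_index_eq_1:
  fixes T :: "complex ^ 'n \<Rightarrow> complex ^ 'n"
  assumes T: "clin_op T" "bij T" "\<And>x. sup_norm (T x) = N x"
  shows "poly_num_index N k = 1"
proof -
  obtain j :: 'n where True by simp
  \<comment> \<open>A monomial of norm 1 shows that the infimum is over a nonempty set, which is
    then \<open>{1}\<close>.\<close>
  define P :: "complex ^ 'n \<Rightarrow> complex ^ 'n" where "P = (\<lambda>x. (\<Prod>i<k. x $ j) *s axis j 1)"
  have P: "homog_poly k P"
    unfolding P_def by (rule homog_poly_prod) (simp add: clin_functional_def)
  have NP: "N (P x) = cmod (x $ j) ^ k" for x
    by (simp add: P_def N_scale N_axis norm_power)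
  have "poly_norm N P = 1"
    unfolding poly_norm_def
  proof (rule cSup_eq_maximum)
    show "1 \<in> {N (P x) | x. N x \<le> 1}"
      by (auto simp: NP N_axis intro!: exI[of _ "axis j 1"])
    show "r \<le> 1" if "r \<in> {N (P x) | x. N x \<le> 1}" for r
      using that cmod_component_le[of _ j] by (auto simp: NP intro!: power_le_one intro: order_trans)
  qed
  with P have "{num_radius N P | P. homog_poly k P \<and> poly_norm N P = 1} = {1}"
    using num_radius_eq_poly_norm[OF T] by (auto intro!: exI[of _ P])
  then show ?thesis
    by (simp add: poly_num_index_def)
qed

section \<open>Coefficient vectors of functionals and attainment of the numerical radius\<close>

lemma cmod_coefficient_le_1:
  assumes "\<And>y. cmod (\<Sum>j\<in>UNIV. a $ j * y $ j) \<le> N y"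
  shows "cmod (a $ j) \<le> 1"
  using assms[of "axis j 1"] unfolding N_axis
  by (simp add: axis_def if_distrib cong: if_cong)

lemma sum_cmod_mult_le:
  assumes "\<And>y. cmod (\<Sum>j\<in>UNIV. a $ j * y $ j) \<le> N y"
  shows "(\<Sum>j\<in>UNIV. cmod (a $ j * y $ j)) \<le> N y"
proof -
  define z :: "complex ^ 'n"
    \<comment> \<open>The phases are chosen to make every \<open>a $ j * z $ j\<close> nonnegative.
      Where \<open>a $ j = 0\<close> the sign is 0, so \<open>y $ j\<close> is kept to preserve the
      modulus and hence \<open>N\<close>.\<close>
    where "z = (\<chi> j. if a $ j = 0 then y $ j else cmod (y $ j) * cnj (sgn (a $ j)))"
  have "a $ j * z $ j = cmod (a $ j * y $ j)" for j
  proof (cases "a $ j = 0")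
    case False
    have "a $ j * cnj (sgn (a $ j)) = cmod (a $ j)"
      using False complex_norm_square[of "a $ j"]
      by (simp add: sgn_eq field_simps power2_eq_square)
    then show ?thesis
      using False by (simp add: z_def norm_mult mult.left_commute[of "a $ j"])
  qed simp
  then have eq: "(\<Sum>j\<in>UNIV. a $ j * z $ j) = complex_of_real (\<Sum>j\<in>UNIV. cmod (a $ j * y $ j))"
    by simp
  have "(\<Sum>j\<in>UNIV. cmod (a $ j * y $ j)) \<le> cmod (\<Sum>j\<in>UNIV. a $ j * z $ j)"
    unfolding eq norm_of_real by (rule abs_ge_self)
  also have "\<dots> \<le> N z"
    by (rule assms)
  also have "N z = N y"
    by (rule N_cong_cmod) (simp add: z_def norm_mult norm_sgn)
  finally show ?thesis .
qed

text \<open>Encoding functionals by coefficient vectors makes the admissible pairs a compact set, on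
  which the continuous objective has a maximum.\<close>

lemma num_radius_attained:
  assumes P: "continuous_on UNIV P"
  shows "\<exists>x a. N x \<le> 1 \<and> (\<forall>y. cmod (\<Sum>j\<in>UNIV. a $ j * y $ j) \<le> N y) \<and>
    (\<Sum>j\<in>UNIV. a $ j * x $ j) = 1 \<and> num_radius N P \<le> cmod (\<Sum>j\<in>UNIV. a $ j * P x $ j)"
proof -
  define D where "D = {a :: complex ^ 'n. \<forall>y. cmod (\<Sum>j\<in>UNIV. a $ j * y $ j) \<le> N y}"
  \<comment> \<open>A pairing equal to 1 with a functional dominated by \<open>N\<close> forces
    \<open>N x = 1\<close> on the ball.\<close>
  define K where "K = ({x. N x \<le> 1} \<times> D) \<inter> {p. (\<Sum>j\<in>UNIV. snd p $ j * fst p $ j) = 1}"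
  have "closed D"
    unfolding D_def by (intro closed_Collect_all closed_Collect_le) (auto intro!: continuous_intros)
  moreover have "norm a \<le> CARD('n)" if "a \<in> D" for a
  proof -
    have "cmod (a $ j) \<le> 1" for j
      using that by (intro cmod_coefficient_le_1) (simp add: D_def)
    then have "(\<Sum>j\<in>UNIV. cmod (a $ j)) \<le> (\<Sum>j\<in>(UNIV :: 'n set). 1)"
      by (rule sum_mono)
    moreover have "norm a \<le> (\<Sum>j\<in>UNIV. cmod (a $ j))"
      unfolding norm_vec_def by (rule L2_set_le_sum) simp
    ultimately show ?thesis by simp
  qed
  then have "bounded D"
    unfolding bounded_iff by blast
  ultimately have "compact D"
    by (simp add: compact_eq_bounded_closed)
  then have "compact K"
    unfolding K_def
    by (intro compact_Int_closed compact_Times compact_ball closed_Collect_eq continuous_intros)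
  have functional: "(x, \<chi> j. f (axis j 1)) \<in> K \<and> f v = (\<Sum>j\<in>UNIV. (\<chi> j. f (axis j 1)) $ j * v $ j)"
    if f: "N x = 1" "clin_functional f" "dual_norm N f = 1" "f x = 1" for x f v
  proof -
    have eq: "(\<Sum>j\<in>UNIV. f (axis j 1) * v $ j) = f v" for v
      unfolding clin_functional_expansion[OF f(2), of v] by (simp add: mult.commute)
    then show ?thesis
      using f cmod_le_dual_norm[OF f(2,3)] by (simp add: K_def D_def)
  qed
  have "K \<noteq> {}"
    using num_radius_set_nonempty[of P] functional by blast
  moreover have "continuous_on K (\<lambda>p. P (fst p))"
    by (rule continuous_on_compose2[OF P]) (auto intro: continuous_intros)
  then have "continuous_on K (\<lambda>p. cmod (\<Sum>j\<in>UNIV. snd p $ j * P (fst p) $ j))"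
    by (intro continuous_intros)
  ultimately obtain p where p: "p \<in> K"
    and max: "\<And>p'. p' \<in> K \<Longrightarrow> cmod (\<Sum>j\<in>UNIV. snd p' $ j * P (fst p') $ j)
        \<le> cmod (\<Sum>j\<in>UNIV. snd p $ j * P (fst p) $ j)"
    using continuous_attains_sup[OF \<open>compact K\<close>] by blast
  have "num_radius N P \<le> cmod (\<Sum>j\<in>UNIV. snd p $ j * P (fst p) $ j)"
    unfolding num_radius_def
  proof (rule cSup_least[OF num_radius_set_nonempty], safe)
    fix x f
    assume "N x = 1" "clin_functional f" "dual_norm N f = 1" "f x = 1"
    note functional[OF this, of "P x"]
    then show "cmod (f (P x)) \<le> cmod (\<Sum>j\<in>UNIV. snd p $ j * P (fst p) $ j)"
      using max[of "(x, \<chi> j. f (axis j 1))"] by simp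
  qed
  then show ?thesis
    using p by (intro exI[of _ "fst p"] exI[of _ "snd p"]) (auto simp: K_def D_def)
qed

end

section \<open>A scalar polynomial with controlled maximisers\<close>

definition ind :: "'n set \<Rightarrow> complex ^ 'n" where
  "ind S = (\<chi> j. if j \<in> S then 1 else 0)"

text \<open>
  With \<open>s = \<Sum>\<^sub>j x\<^sub>j\<close>, this is \<open>s\<^sup>l (s\<^sup>2 + \<Sum>\<^sub>i\<^sub>\<noteq>\<^sub>j x\<^sub>i x\<^sub>j)\<close>: the term \<open>s\<^sup>2\<close> forces equal phases at a
  maximiser, and the mixed terms rule out vanishing coordinates.
\<close>
definition symm_poly :: "'n set \<Rightarrow> nat \<Rightarrow> complex ^ 'n \<Rightarrow> complex" where
  "symm_poly S l x = (\<Sum>j\<in>S. x $ j) ^ l * (2 * (\<Sum>j\<in>S. x $ j)\<^sup>2 - (\<Sum>j\<in>S. (x $ j)\<^sup>2))"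

text \<open>The off-diagonal products make the difference visibly nonnegative for nonnegative reals
  and open to termwise estimates.\<close>

lemma square_sum_diff_sum_squares:
  fixes a :: "'a \<Rightarrow> 'b::comm_ring_1"
  assumes "finite S"
  shows "(\<Sum>j\<in>S. a j)\<^sup>2 - (\<Sum>j\<in>S. (a j)\<^sup>2) = (\<Sum>i\<in>S. a i * (\<Sum>j\<in>S-{i}. a j))"
proof -
  have "(\<Sum>i\<in>S. a i * (\<Sum>j\<in>S-{i}. a j)) = (\<Sum>i\<in>S. a i * (\<Sum>j\<in>S. a j) - (a i)\<^sup>2)"
    using assms by (intro sum.cong) (auto simp: sum_diff1 power2_eq_square right_diff_distrib)
  then show ?thesis
    by (simp add: sum_subtractf power2_eq_square sum_distrib_right)
qed

text \<open>Only the mixed terms are replaced by their moduli; keeping the modulus of the sum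
  elsewhere lets the bound detect unequal phases.\<close>

lemma cmod_symm_poly_le:
  fixes x :: "complex ^ 'n::finite"
  shows "cmod (symm_poly S l x) \<le> cmod (\<Sum>j\<in>S. x $ j) ^ l * ((cmod (\<Sum>j\<in>S. x $ j))\<^sup>2 +
    ((\<Sum>j\<in>S. cmod (x $ j))\<^sup>2 - (\<Sum>j\<in>S. (cmod (x $ j))\<^sup>2)))"
proof -
  let ?s = "\<Sum>j\<in>S. x $ j"
  have "cmod (?s\<^sup>2 - (\<Sum>j\<in>S. (x $ j)\<^sup>2)) \<le> (\<Sum>i\<in>S. cmod (x $ i) * (\<Sum>j\<in>S-{i}. cmod (x $ j)))"
    unfolding square_sum_diff_sum_squares[OF finite]
    by (intro order_trans[OF norm_sum] sum_mono)
      (auto simp: norm_mult intro: mult_left_mono norm_sum)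
  then have "cmod (?s\<^sup>2 - (\<Sum>j\<in>S. (x $ j)\<^sup>2))
      \<le> (\<Sum>j\<in>S. cmod (x $ j))\<^sup>2 - (\<Sum>j\<in>S. (cmod (x $ j))\<^sup>2)"
    unfolding square_sum_diff_sum_squares[OF finite] .
  moreover have "symm_poly S l x = ?s ^ l * (?s\<^sup>2 + (?s\<^sup>2 - (\<Sum>j\<in>S. (x $ j)\<^sup>2)))"
    by (simp add: symm_poly_def)
  ultimately show ?thesis
    using norm_triangle_ineq[of "?s\<^sup>2" "?s\<^sup>2 - (\<Sum>j\<in>S. (x $ j)\<^sup>2)"]
    by (auto simp: norm_mult norm_power intro!: mult_left_mono)
qed

text \<open>With \<open>s\<close> the sum over \<open>S\<close>, the polynomial is
  \<open>2 * s ^ (l + 2)\<close> minus the sum of the products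
  \<open>s ^ l * (x $ j)\<^sup>2\<close>.\<close>

lemma homog_poly_symm_poly:
  fixes u :: "complex ^ 'n::finite"
  assumes "S \<noteq> {}"
  shows "homog_poly (Suc (Suc l)) (\<lambda>x. symm_poly S l x *s u)"
proof -
  let ?s = "\<lambda>x :: complex ^ 'n. \<Sum>j\<in>S. x $ j"
  have s: "clin_functional ?s"
    by (simp add: clin_functional_def sum.distrib sum_distrib_left)
  have "homog_poly (Suc (Suc l)) (\<lambda>x. (\<Prod>i<Suc (Suc l). ?s x) *s (2 *s u))"
    by (intro homog_poly_prod s)
  moreover have "homog_poly (Suc (Suc l)) (\<lambda>x. \<Sum>j\<in>S. (\<Prod>i<Suc (Suc l). if i < l then ?s x else x $ j) *s (- u))"
  proof (intro homog_poly_sum assms finite)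
    fix j
    have "clin_functional (\<lambda>x :: complex ^ 'n. if i < l then ?s x else x $ j)" for i
      using s by (cases "i < l") (auto simp: clin_functional_def)
    then show "homog_poly (Suc (Suc l)) (\<lambda>x. (\<Prod>i<Suc (Suc l). if i < l then ?s x else x $ j) *s (- u))"
      by (rule homog_poly_prod)
  qed
  ultimately have "homog_poly (Suc (Suc l)) (\<lambda>x. (\<Prod>i<Suc (Suc l). ?s x) *s (2 *s u) +
      (\<Sum>j\<in>S. (\<Prod>i<Suc (Suc l). if i < l then ?s x else x $ j) *s (- u)))"
    by (rule homog_poly_add)
  moreover have "(\<Prod>i<Suc (Suc l). ?s x) *s (2 *s u) +
      (\<Sum>j\<in>S. (\<Prod>i<Suc (Suc l). if i < l then ?s x else x $ j) *s (- u)) = symm_poly S l x *s u" for x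
  proof -
    define s where "s = ?s x"
    have "(\<Prod>i<Suc (Suc l). if i < l then s else x $ j) = s ^ l * (x $ j)\<^sup>2" for j
      by (simp add: power2_eq_square mult.assoc)
    then show ?thesis
      unfolding symm_poly_def s_def[symmetric]
      by (simp add: vec_eq_iff algebra_simps power2_eq_square sum_negf sum_distrib_left)
  qed
  ultimately show ?thesis by simp
qed

context absolute_normed
begin

text \<open>A zero coordinate in \<open>S\<close> caps the modulus at
  \<open>m ^ l * (2 * m\<^sup>2 - m)\<close>, which the vector \<open>y\<close> exceeds; unequal
  phases are beaten by \<open>abs_vec x\<close>.\<close>

lemma symm_poly_maximizer:
  assumes S: "card S \<ge> 2" and min: "\<And>j. j \<in> S \<Longrightarrow> N (ind (S - {j})) \<le> 1"
    and x: "N x \<le> 1" and max: "\<And>y. N y \<le> 1 \<Longrightarrow> cmod (symm_poly S l y) \<le> cmod (symm_poly S l x)"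
  shows "j \<in> S \<Longrightarrow> x $ j \<noteq> 0" and "(\<Sum>j\<in>S. cmod (x $ j)) \<le> cmod (\<Sum>j\<in>S. x $ j)"
proof -
  define m where "m = real (card S) - 1"
  have m: "m \<ge> 1" "real (card S) = m + 1"
    using S by (auto simp: m_def)
  define A where "A = (\<Sum>j\<in>S. cmod (x $ j))"
  define D where "D = A\<^sup>2 - (\<Sum>j\<in>S. (cmod (x $ j))\<^sup>2)"
  have A: "A \<ge> 0"
    by (simp add: A_def sum_nonneg)
  have D: "D \<ge> 0"
    unfolding D_def A_def square_sum_diff_sum_squares[OF finite]
    by (intro sum_nonneg mult_nonneg_nonneg) auto
  have le: "cmod (symm_poly S l x) \<le> cmod (\<Sum>j\<in>S. x $ j) ^ l * ((cmod (\<Sum>j\<in>S. x $ j))\<^sup>2 + D)"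
    unfolding D_def A_def by (rule cmod_symm_poly_le)
  have sA: "cmod (\<Sum>j\<in>S. x $ j) \<le> A"
    unfolding A_def by (rule norm_sum)
  have le_A: "cmod (symm_poly S l x) \<le> A ^ l * (A\<^sup>2 + D)"
    using A D sA by (intro order_trans[OF le] mult_mono power_mono add_mono) auto
  \<comment> \<open>The mean of the vectors \<open>ind (S - {j})\<close>; it beats every \<open>x\<close> with a zero coordinate in \<open>S\<close>.\<close>
  define y :: "complex ^ 'n" where "y = complex_of_real (m / (m + 1)) *s ind S"
  have "N y \<le> 1"
  proof -
    have "(\<Sum>j\<in>S. ind (S - {j})) $ i = (m *s ind S) $ i" for i
    proof -
      have "(\<Sum>j\<in>S. ind (S - {j})) $ i = (\<Sum>j\<in>S. if i \<in> S \<and> i \<noteq> j then 1 else 0)"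
        by (simp add: ind_def)
      also have "\<dots> = of_nat (card {j \<in> S. i \<in> S \<and> i \<noteq> j})"
        by (simp flip: sum.inter_filter)
      also have "\<dots> = (m *s ind S) $ i"
      proof (cases "i \<in> S")
        case True
        then have "{j \<in> S. i \<in> S \<and> i \<noteq> j} = S - {i}" by auto
        then show ?thesis
          using True S by (simp add: ind_def m_def card_Diff_singleton of_nat_diff)
      qed (simp add: ind_def)
      finally show ?thesis .
    qed
    then have eq: "(\<Sum>j\<in>S. ind (S - {j})) = m *s ind S"
      unfolding vec_eq_iff by blast
    have "m * N (ind S) = N (\<Sum>j\<in>S. ind (S - {j}))"
      unfolding eq N_scale using m by simp
    also have "\<dots> \<le> (\<Sum>j\<in>S. 1)"
      by (intro order_trans[OF N_sum] sum_mono min) auto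
    finally have "m * N (ind S) \<le> m + 1"
      using m by simp
    moreover have "N y = m * N (ind S) / (m + 1)"
      unfolding y_def N_scale norm_of_real using m by simp
    ultimately show ?thesis
      using m by (simp add: divide_le_eq)
  qed
  have eq: "symm_poly S l y = complex_of_real (m ^ l * (2 * m\<^sup>2 - m\<^sup>2 / (m + 1)))"
  proof -
    define c where "c = m / (m + 1)"
    have "y $ j = complex_of_real c" if "j \<in> S" for j
      using that by (simp add: y_def ind_def c_def)
    then have "symm_poly S l y = complex_of_real (((m + 1) * c) ^ l * (2 * ((m + 1) * c)\<^sup>2 - (m + 1) * c\<^sup>2))"
      using m(2) by (simp add: symm_poly_def flip: m(2))
    moreover have "(m + 1) * c = m" "(m + 1) * c\<^sup>2 = m\<^sup>2 / (m + 1)"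
      using m by (auto simp: c_def power2_eq_square)
    ultimately show ?thesis by simp
  qed
  have ge: "m ^ l * (2 * m\<^sup>2 - m\<^sup>2 / (m + 1)) \<le> cmod (symm_poly S l x)"
    using max[OF \<open>N y \<le> 1\<close>] unfolding eq norm_of_real by (rule abs_le_D1)
  \<comment> \<open>The left side is the sum of the squares of \<open>y\<close> over
    \<open>S\<close>; the right side is the term subtracted in the bound for a vanishing coordinate.
    This gap decides the comparison.\<close>
  have *: "m\<^sup>2 / (m + 1) < m"
    using m by (simp add: field_simps power2_eq_square)
  show "x $ i \<noteq> 0" if i: "i \<in> S" for i
  proof
    assume 0: "x $ i = 0"
    have card: "real (card (S - {i})) = m"
      using i S by (simp add: m_def card_Diff_singleton of_nat_diff)
    have x1: "cmod (x $ j) \<le> 1" for j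
      using cmod_component_le[of x j] x by simp
    have A': "A = (\<Sum>j\<in>S-{i}. cmod (x $ j))"
      using i 0 by (simp add: A_def sum.remove[of S i])
    have "A \<le> (\<Sum>j\<in>S-{i}. 1)"
      unfolding A' by (intro sum_mono x1)
    then have "A \<le> m"
      using card by simp
    have "D = A\<^sup>2 - (\<Sum>j\<in>S-{i}. (cmod (x $ j))\<^sup>2)"
      using i 0 by (simp add: D_def sum.remove[of S i])
    also have "\<dots> = (\<Sum>a\<in>S-{i}. cmod (x $ a) * (\<Sum>j\<in>S-{i}-{a}. cmod (x $ j)))"
      unfolding A' by (rule square_sum_diff_sum_squares) simp
    \<comment> \<open>Of the \<open>m\<close> remaining indices, each is paired with the
      \<open>m - 1\<close> others.\<close>
    also have "\<dots> \<le> (\<Sum>a\<in>S-{i}. 1 * (m - 1))"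
    proof (intro sum_mono mult_mono x1)
      fix a assume a: "a \<in> S - {i}"
      have "(\<Sum>j\<in>S-{i}-{a}. cmod (x $ j)) \<le> (\<Sum>j\<in>S-{i}-{a}. 1)"
        by (intro sum_mono x1)
      also have "\<dots> = m - 1"
        using a card m by (simp add: card_Diff_singleton of_nat_diff)
      finally show "(\<Sum>j\<in>S-{i}-{a}. cmod (x $ j)) \<le> m - 1" .
    qed (auto simp: sum_nonneg)
    also have "\<dots> = m * (m - 1)"
      using card by simp
    finally have "A ^ l * (A\<^sup>2 + D) \<le> m ^ l * (m\<^sup>2 + m * (m - 1))"
      using A D \<open>A \<le> m\<close> m by (intro mult_mono power_mono add_mono) auto
    also have "\<dots> = m ^ l * (2 * m\<^sup>2 - m)"
      by (simp add: power2_eq_square algebra_simps)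
    also have "\<dots> < m ^ l * (2 * m\<^sup>2 - m\<^sup>2 / (m + 1))"
      using * m by (intro mult_strict_left_mono) auto
    finally show False
      using ge le_A by linarith
  qed
  show "(\<Sum>j\<in>S. cmod (x $ j)) \<le> cmod (\<Sum>j\<in>S. x $ j)"
  proof (rule ccontr)
    assume "\<not> ?thesis"
    then have less: "cmod (\<Sum>j\<in>S. x $ j) < A"
      by (simp add: A_def)
    then have "A > 0"
      using norm_ge_zero order_le_less_trans by blast
    have "cmod (symm_poly S l x) \<le> A ^ l * ((cmod (\<Sum>j\<in>S. x $ j))\<^sup>2 + D)"
      using D sA by (intro order_trans[OF le] mult_right_mono power_mono) auto
    also have "\<dots> < A ^ l * (A\<^sup>2 + D)"
      using less \<open>A > 0\<close> by (intro mult_strict_left_mono add_strict_right_mono power_strict_mono) auto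
    \<comment> \<open>At nonnegative coordinates the triangle inequalities used above are
      equalities.\<close>
    also have "\<dots> = cmod (symm_poly S l (abs_vec x))"
    proof -
      have "symm_poly S l (abs_vec x) = complex_of_real (A ^ l * (A\<^sup>2 + D))"
        by (simp add: symm_poly_def abs_vec_def A_def D_def)
      then have "cmod (symm_poly S l (abs_vec x)) = \<bar>A ^ l * (A\<^sup>2 + D)\<bar>"
        by (simp only: norm_of_real)
      then show ?thesis
        using A D by simp
    qed
    also have "\<dots> \<le> cmod (symm_poly S l x)"
      using x by (intro max) (simp add: N_abs_vec)
    finally show False by simp
  qed
qed

section \<open>Indicator vectors and recovery of the supremum norm\<close>

lemma N_ind_le_1:
  assumes index: "poly_num_index N k = 1" and k: "k \<ge> 2"
  shows "N (ind S) \<le> 1"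
proof -
  have "finite S" by simp
  then show ?thesis
  proof (induction S rule: finite_psubset_induct)
    case (psubset S)
    show ?case
    proof (rule ccontr)
      assume "\<not> N (ind S) \<le> 1"
      then have gt: "N (ind S) > 1" by simp
      have "S \<noteq> {}"
      proof
        assume "S = {}"
        then have "ind S = (0 :: complex ^ 'n)"
          by (simp add: ind_def vec_eq_iff)
        then show False
          using gt N_eq_0[of 0] by simp
      qed
      have "card S \<noteq> 1"
      proof
        assume "card S = 1"
        then obtain j where "S = {j}"
          by (rule card_1_singletonE)
        then have "ind S = (axis j 1 :: complex ^ 'n)"
          by (simp add: ind_def axis_def vec_eq_iff)
        then show False
          using gt N_axis[of j] by simp
      qed
      moreover have "card S \<noteq> 0"
        using \<open>S \<noteq> {}\<close> by simp
      ultimately have card: "card S \<ge> 2" by linarith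
      \<comment> \<open>The induction hypothesis makes \<open>S\<close> a minimal counterexample, as
        \<open>symm_poly_maximizer\<close> requires.\<close>
      have min: "N (ind (S - {j})) \<le> 1" if "j \<in> S" for j
        using that by (intro psubset.IH) auto
      obtain l where l: "k = Suc (Suc l)"
        using k by (metis add_2_eq_Suc le_Suc_ex)
      obtain w :: "'n \<Rightarrow> complex" where w: "inj w" "\<And>j. cmod (w j) = 1"
        using ex_inj_unimodular by blast
      define u :: "complex ^ 'n" where "u = (\<chi> j. if j \<in> S then w j / N (ind S) else 0)"
      have u: "N u = 1"
      proof -
        have "N u = N (complex_of_real (1 / N (ind S)) *s ind S)"
          using w(2) by (intro N_cong_cmod) (simp add: u_def ind_def norm_divide)
        then show ?thesis
          using gt unfolding N_scale norm_of_real by simp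
      qed
      define q where "q = symm_poly S l"
      have "continuous_on A q" for A
        unfolding q_def symm_poly_def by (intro continuous_intros)
      moreover have "{x. N x \<le> 1} \<noteq> {}"
        using eq_refl[OF N_axis] by blast
      ultimately obtain x0 where x0: "N x0 \<le> 1" and q_le: "\<And>x. N x \<le> 1 \<Longrightarrow> cmod (q x) \<le> cmod (q x0)"
        using continuous_attains_sup[OF compact_ball, of "\<lambda>x. cmod (q x)"]
        by (auto simp: continuous_on_norm)
      define M where "M = cmod (q x0)"
      have "M > 0"
      proof -
        obtain j where j: "j \<in> S"
          using \<open>S \<noteq> {}\<close> by blast
        have "(\<Sum>i\<in>S. axis j 1 $ i) = (1 :: complex)"
          using j by (simp add: axis_def)
        moreover have "(axis j 1 $ i)\<^sup>2 = (axis j 1 $ i :: complex)" for i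
          by (simp add: axis_def)
        ultimately have "q (axis j 1) = 1"
          by (simp add: q_def symm_poly_def)
        then show ?thesis
          using q_le[OF eq_refl[OF N_axis[of j]]] by (auto simp: M_def)
      qed
      define P where "P = (\<lambda>x. q x *s ((1 / complex_of_real M) *s u))"
      have P: "homog_poly k P"
        unfolding P_def q_def l by (rule homog_poly_symm_poly[OF \<open>S \<noteq> {}\<close>])
      note contP = homog_poly_continuous[OF P]
      have NP: "N (P x) = cmod (q x) / M" for x
        using \<open>M > 0\<close> by (simp add: P_def N_scale norm_divide u)
      have "poly_norm N P = 1"
        unfolding poly_norm_def
      proof (rule cSup_eq_maximum)
        show "1 \<in> {N (P x) | x. N x \<le> 1}"
          using x0 \<open>M > 0\<close> by (auto simp: NP M_def intro!: exI[of _ x0])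
        show "r \<le> 1" if "r \<in> {N (P x) | x. N x \<le> 1}" for r
          using that q_le \<open>M > 0\<close> by (auto simp: NP M_def)
      qed
      then have index_le: "poly_num_index N k \<le> num_radius N P"
        unfolding poly_num_index_def using P
        by (intro cInf_lower bdd_belowI[of _ 0])
          (auto intro: num_radius_nonneg homog_poly_continuous)
      obtain x a where x: "N x \<le> 1"
        and a: "\<And>y. cmod (\<Sum>j\<in>UNIV. a $ j * y $ j) \<le> N y"
        and ax: "(\<Sum>j\<in>UNIV. a $ j * x $ j) = 1"
        and att: "num_radius N P \<le> cmod (\<Sum>j\<in>UNIV. a $ j * P x $ j)"
        using num_radius_attained[OF contP] by blast
      have "(\<Sum>j\<in>UNIV. a $ j * P x $ j) = q x / M * (\<Sum>j\<in>UNIV. a $ j * u $ j)"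
        by (simp add: P_def sum_distrib_left mult_ac)
      then have "cmod (\<Sum>j\<in>UNIV. a $ j * P x $ j) = cmod (q x) / M * cmod (\<Sum>j\<in>UNIV. a $ j * u $ j)"
        using \<open>M > 0\<close> by (simp add: norm_mult norm_divide)
      \<comment> \<open>Both factors are at most 1, so both equal 1: \<open>x\<close> maximises
        \<open>q\<close>, and the functional has modulus 1 at \<open>u\<close>.\<close>
      then have ge: "1 \<le> cmod (q x) / M * cmod (\<Sum>j\<in>UNIV. a $ j * u $ j)"
        using index index_le att by linarith
      have qx: "cmod (q x) / M \<le> 1"
        using q_le[OF x] \<open>M > 0\<close> by (simp add: M_def)
      have au: "cmod (\<Sum>j\<in>UNIV. a $ j * u $ j) \<le> 1"
        using a[of u] u by simp
      have "1 \<le> cmod (q x) / M"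
        using \<open>M > 0\<close> by (intro order_trans[OF ge mult_left_le[OF au]]) simp
      then have max: "cmod (q y) \<le> cmod (q x)" if "N y \<le> 1" for y
        using q_le[OF that] \<open>M > 0\<close> by (simp add: M_def field_simps)
      have au': "1 \<le> cmod (\<Sum>j\<in>UNIV. a $ j * u $ j)"
        using \<open>M > 0\<close> by (intro order_trans[OF ge mult_left_le_one_le[OF _ _ qx]]) simp_all
      have x_nonzero: "x $ j \<noteq> 0" if "j \<in> S" for j
        by (rule symm_poly_maximizer(1)[OF card min x max[unfolded q_def] that])
      have aligned: "(\<Sum>j\<in>S. cmod (x $ j)) \<le> cmod (\<Sum>j\<in>S. x $ j)"
        by (rule symm_poly_maximizer(2)[OF card min x max[unfolded q_def]])
      define \<theta> where "\<theta> = sgn (\<Sum>j\<in>S. x $ j)"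
      have x\<theta>: "x $ j = cmod (x $ j) * \<theta>" if "j \<in> S" for j
        unfolding \<theta>_def by (rule cmod_sum_eq_sum_cmod[OF finite aligned that])
      have "(\<Sum>j\<in>UNIV. cmod (a $ j * x $ j)) \<le> cmod (\<Sum>j\<in>UNIV. a $ j * x $ j)"
        using sum_cmod_mult_le[OF a, of x] x ax by simp
      from cmod_sum_eq_sum_cmod[OF finite this UNIV_I]
      have ax': "a $ j * x $ j = cmod (a $ j * x $ j)" for j
        by (simp add: ax)
      \<comment> \<open>Each \<open>a $ j * x $ j\<close> is nonnegative; cancelling the nonzero
        modulus of \<open>x $ j\<close> leaves the common phase \<open>\<theta>\<close>.\<close>
      have a\<theta>: "a $ j * \<theta> = cmod (a $ j)" if "j \<in> S" for j
      proof -
        have "a $ j * (cmod (x $ j) * \<theta>) = cmod (a $ j) * cmod (x $ j)"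
          using ax'[of j] x\<theta>[OF that] by (simp add: norm_mult)
        then show ?thesis
          using x_nonzero[OF that] by simp
      qed
      define \<sigma> where "\<sigma> = sgn (\<Sum>j\<in>UNIV. a $ j * u $ j)"
      have "(\<Sum>j\<in>UNIV. cmod (a $ j * u $ j)) \<le> cmod (\<Sum>j\<in>UNIV. a $ j * u $ j)"
        using sum_cmod_mult_le[OF a, of u] u au' by simp
      from cmod_sum_eq_sum_cmod[OF finite this UNIV_I]
      have a\<sigma>: "a $ j * u $ j = cmod (a $ j * u $ j) * \<sigma>" for j
        by (simp add: \<sigma>_def)
      \<comment> \<open>Alignment at both \<open>x\<close> and \<open>u\<close> prescribes one value
        of \<open>w j\<close>, so injectivity of \<open>w\<close> permits at most one such
        \<open>j\<close>.\<close>
      have "w j = \<sigma> * \<theta>" if j: "j \<in> S" "a $ j \<noteq> 0" for j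
      proof -
        have "a $ j * w j = cmod (a $ j) * \<sigma>"
          using a\<sigma>[of j] j gt w(2)[of j] by (simp add: u_def norm_mult norm_divide)
        then have "(a $ j * \<theta>) * w j = cmod (a $ j) * (\<sigma> * \<theta>)"
          by (simp add: mult_ac)
        then show ?thesis
          unfolding a\<theta>[OF j(1)] using j(2) by simp
      qed
      then have unique: "i = j" if "i \<in> S" "a $ i \<noteq> 0" "j \<in> S" "a $ j \<noteq> 0" for i j
        using that w(1) by (metis injD)
      have "(\<Sum>j\<in>S. cmod (a $ j)) \<le> 1"
      proof (cases "\<exists>i\<in>S. a $ i \<noteq> 0")
        case True
        then obtain i where i: "i \<in> S" "a $ i \<noteq> 0" by blast
        have "(\<Sum>j\<in>S. cmod (a $ j)) = (\<Sum>j\<in>{i}. cmod (a $ j))"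
          using i unique by (intro sum.mono_neutral_right) auto
        then show ?thesis
          using cmod_coefficient_le_1[OF a, of i] by simp
      qed auto
      moreover have "1 \<le> (\<Sum>j\<in>S. cmod (a $ j)) / N (ind S)"
      proof -
        have "1 \<le> (\<Sum>j\<in>UNIV. cmod (a $ j * u $ j))"
          using au' norm_sum order_trans by blast
        also have "\<dots> = (\<Sum>j\<in>S. cmod (a $ j * u $ j))"
          by (intro sum.mono_neutral_right) (auto simp: u_def)
        also have "\<dots> = (\<Sum>j\<in>S. cmod (a $ j) / N (ind S))"
          using gt w(2) by (intro sum.cong) (auto simp: u_def norm_mult norm_divide)
        finally show ?thesis
          by (simp add: sum_divide_distrib)
      qed
      ultimately show False
        using gt by (simp add: field_simps)
    qed
  qed
qed

text \<open>A coordinate in \<open>[0, 1]\<close> is a convex combination of 1 and -1, and these two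
  choices give the same \<open>N\<close>. Coordinates can thus be raised to 1 one at a time without
  decreasing \<open>N\<close>.\<close>

lemma N_le_N_ind_UNIV:
  assumes "\<And>j. cmod (x $ j) \<le> 1"
  shows "N x \<le> N (ind UNIV)"
proof -
  have "N y \<le> N (ind UNIV)"
    if "finite F" "\<And>j. j \<notin> F \<Longrightarrow> y $ j = 1" "\<And>j. \<exists>t\<in>{0..1::real}. y $ j = t" for F y
    using that
  proof (induction arbitrary: y)
    case empty
    then have "y = ind UNIV"
      by (simp add: ind_def vec_eq_iff)
    then show ?case by simp
  next
    case (insert i F)
    obtain t :: real where t: "t \<in> {0..1}" "y $ i = t"
      using insert.prems(2) by blast
    define z where "z c = (\<chi> j. if j = i then c else y $ j)" for c
    have "y = complex_of_real ((1 + t) / 2) *s z 1 + complex_of_real ((1 - t) / 2) *s z (-1)"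
      by (auto simp: z_def vec_eq_iff t(2) field_simps)
    then have "N y \<le> (1 + t) / 2 * N (z 1) + (1 - t) / 2 * N (z (-1))"
      using N_add[of "complex_of_real ((1 + t) / 2) *s z 1" "complex_of_real ((1 - t) / 2) *s z (-1)"]
        t(1) unfolding N_scale norm_of_real by simp
    also have "N (z (-1)) = N (z 1)"
      by (rule N_cong_cmod) (simp add: z_def)
    also have "(1 + t) / 2 * N (z 1) + (1 - t) / 2 * N (z 1) = N (z 1)"
      by (simp add: field_simps)
    also have "\<dots> \<le> N (ind UNIV)"
      using insert.prems by (intro insert.IH) (auto simp: z_def intro!: bexI[of _ 1])
    finally show ?case .
  qed
  \<comment> \<open>Passing to moduli provides the real coordinates in
    \<open>[0, 1]\<close>.\<close>
  from this[of UNIV "abs_vec x"] have "N (abs_vec x) \<le> N (ind UNIV)"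
    using assms by (auto simp: abs_vec_def)
  then show ?thesis by (simp add: N_abs_vec)
qed

lemma sup_norm_eq_N:
  assumes "N (ind UNIV) \<le> 1"
  shows "sup_norm x = N x"
proof (rule antisym)
  show le: "sup_norm x \<le> N x"
    using sup_norm_attained[of x] cmod_component_le[of x] by metis
  show "N x \<le> sup_norm x"
  proof (cases "sup_norm x > 0")
    case True
    have "N (complex_of_real (1 / sup_norm x) *s x) \<le> 1"
      using True cmod_le_sup_norm[of x]
      by (intro order_trans[OF N_le_N_ind_UNIV assms]) (simp add: norm_divide)
    then show ?thesis
      using True unfolding N_scale norm_of_real by (simp add: field_simps)
  next
    case False
    then have "x $ j = 0" for j
      using cmod_le_sup_norm[of x j] by (smt (verit) zero_less_norm_iff)
    then have "x = 0"
      by (simp add: vec_eq_iff)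
    then show ?thesis
      using N_eq_0[of 0] cmod_le_sup_norm[of x] by simp
  qed
qed

end

theorem theorem4p6:
  fixes N :: "complex ^ 'n::finite \<Rightarrow> real" and k :: nat
  assumes "absolute_norm N" and "k \<ge> 2"
  shows "poly_num_index N k = 1 \<longleftrightarrow>
         (\<exists>T :: complex ^ 'n \<Rightarrow> complex ^ 'n. clin_op T \<and> bij T \<and> (\<forall>x. sup_norm (T x) = N x))"
proof -
  interpret absolute_normed N
    by unfold_locales (rule assms(1))
  show ?thesis
  proof
    assume "poly_num_index N k = 1"
    then have "sup_norm x = N x" for x
      using assms(2) by (intro sup_norm_eq_N N_ind_le_1)
    then show "\<exists>T :: complex ^ 'n \<Rightarrow> complex ^ 'n. clin_op T \<and> bij T \<and> (\<forall>x. sup_norm (T x) = N x)"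
      by (intro exI[of _ id]) (simp add: clin_op_def)
  qed (use poly_num_index_eq_1 in blast)
qed

end
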